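(* Let $k$ be a field of characteristic zero, $A$ an associative (not necessarily unital) $k$-algebra and $I\subseteq A$ a two-sided ideal, such that $I$ and $A$ have local left units. Let $n\ge1$ and suppose $\varphi\in F_nC_n(A,I)$ is a cycle, i.e. $b\varphi=0$. Write $\varphi=\sum_j\lambda_j\varphi_j$ (finite sum, $\lambda_j\in k$) with each $\varphi_j$ a pure tensor in the standard tensor basis, say $\varphi_j=f_0\otimes f_1\otimes\cdots\otimes f_n$ with $f_0\in I$ (the slots depending on $j$). Let $e_n\in I$ be a local left unit for the set of the $f_0$-slots of all $\varphi_j$, and, inductively downward for $2\le i\le n$, let $e_{i-1}\in I$ be a local left unit for $\{e_i\}\cup\{f_ie_i\}$, where $f_i$ runs over the $f_i$-slots of all $\varphi_j$. For each $\varphi_j=f_0\otimes\cdots\otimes f_n$ define $$\varphi_j'=\sum_{s_1,\dots,s_n\in\{+,-\}}(-1)^{\#\{i\,:\,s_i=-\}}\;L_1^{s_1}L_2^{s_2}\cdots L_n^{s_n}(f_0),$$ where, for a tensor $w_0\otimes\cdots\otimes w_m$, $$L_i^{+}(w_0\otimes\cdots\otimes w_m)=e_i\otimes f_iw_0\otimes w_1\otimes\cdots\otimes w_m,\qquad L_i^{-}(w_0\otimes\cdots\otimes w_m)=f_ie_i\otimes w_0\otimes w_1\otimes\cdots\otimes w_m .$$ Then $\varphi':=\sum_j\lambda_j\varphi_j'\in C_n(I)$ is a representative of the same homology class (in $HH_n(A,I)$) as $\varphi$.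
   Context: All tensor products are over $k$. A local left unit for a finite subset $S$ of an algebra is an element $e$ with $es=s$ for all $s\in S$; an algebra $R$ has local left units if every finite subset of $R$ has a local left unit in $R$. For an algebra $R$, $C_n(R):=R^{\otimes n+1}$ with differential $$b(f_0\otimes\cdots\otimes f_n)=\sum_{i=0}^{n-1}(-1)^i f_0\otimes\cdots\otimes f_if_{i+1}\otimes\cdots\otimes f_n+(-1)^n f_nf_0\otimes f_1\otimes\cdots\otimes f_{n-1}$$ (and $b=0$ on $C_0(R)$). $C_n(A,I):=\ker(C_n(A)\to C_n(A/I))$ and $HH_n(A,I):=H_n(C_\bullet(A,I),b)$. $F_pC_n(A)\subseteq C_n(A)$ is the $k$-linear span of pure tensors $f_0\otimes\cdots\otimes f_n$ with $f_0,\dots,f_{n-p}\in I$, and $F_pC_n(A,I):=F_pC_n(A)\cap C_n(A,I)$; so $F_nC_n(A,I)=I\otimes A^{\otimes n}$ and $F_0C_n(A,I)=C_n(I)$. The standard tensor basis: fix a $k$-vector space splitting $A\simeq I\oplus A/I$, bases $\mathcal B_I$ of $I$ and $\mathcal B_{A/I}$ of $A/I$, and let $\mathcal B=\mathcal B_I\cup\mathcal B_{A/I}$, regarded as a basis of $A$ via the splitting; the standard tensor basis of $F_nC_n(A,I)$ is $\{b_0\otimes\cdots\otimes b_n\mid b_0\in\mathcal B_I;\ b_1,\dots,b_n\in\mathcal B\}$. *)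

theory Defs
  imports Complex_Main "HOL-Library.Poly_Mapping" "HOL-Library.Set_Algebras"
begin

section \<open>Non-unital algebras, ideals, local units\<close>

text \<open>The class \<^class>\<open>ring\<close> does not include a unit. The algebra is the whole type.\<close>

locale nonunital_algebra = vector_space s
  for s :: "'k::field \<Rightarrow> 'a::ring \<Rightarrow> 'a" +
  assumes scale_mult_left: "s c x * y = s c (x * y)"
    and scale_mult_right: "x * s c y = s c (x * y)"

definition two_sided_ideal :: "('k::field \<Rightarrow> 'a::ring \<Rightarrow> 'a) \<Rightarrow> 'a set \<Rightarrow> bool" where
  "two_sided_ideal s I \<longleftrightarrow>
    module.subspace s I \<and> (\<forall>a. \<forall>x\<in>I. a * x \<in> I \<and> x * a \<in> I)"

definition local_left_unit :: "'a::times \<Rightarrow> 'a set \<Rightarrow> bool" where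
  "local_left_unit e S \<longleftrightarrow> (\<forall>x\<in>S. e * x = x)"

definition has_local_left_units :: "'a::times set \<Rightarrow> bool" where
  "has_local_left_units R \<longleftrightarrow> (\<forall>S. finite S \<and> S \<subseteq> R \<longrightarrow> (\<exists>e\<in>R. local_left_unit e S))"


section \<open>The quotient vector space $A/I$\<close>

text \<open>
  Elements of the quotient are the cosets \<^term>\<open>a +o I\<close>, added as sets. Adding \<^term>\<open>I\<close> in the
  scalar action only matters for the scalar \<^term>\<open>0\<close>. Likewise, the empty sum of sets is
  \<^term>\<open>{0}\<close> and not the coset \<^term>\<open>I\<close>, hence the summand \<^term>\<open>I\<close> in the linear combinations.
\<close>

definition quot :: "'a::plus set \<Rightarrow> 'a set set" where
  "quot I = (\<lambda>a. a +o I) ` UNIV"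

definition quot_scale :: "('k \<Rightarrow> 'a::plus \<Rightarrow> 'a) \<Rightarrow> 'a set \<Rightarrow> 'k \<Rightarrow> 'a set \<Rightarrow> 'a set" where
  "quot_scale s I c X = s c ` X + I"

definition quot_lincomb ::
    "('k \<Rightarrow> 'a::comm_monoid_add \<Rightarrow> 'a) \<Rightarrow> 'a set \<Rightarrow> 'a set set \<Rightarrow> ('a set \<Rightarrow> 'k) \<Rightarrow> 'a set" where
  "quot_lincomb s I T c = (\<Sum>X\<in>T. quot_scale s I (c X) X) + I"

definition quot_basis :: "('k::field \<Rightarrow> 'a::ring \<Rightarrow> 'a) \<Rightarrow> 'a set \<Rightarrow> 'a set set \<Rightarrow> bool" where
  "quot_basis s I Q \<longleftrightarrow> Q \<subseteq> quot I \<and>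
    (\<forall>Y\<in>quot I. \<exists>T c. finite T \<and> T \<subseteq> Q \<and> Y = quot_lincomb s I T c) \<and>
    (\<forall>T c. finite T \<and> T \<subseteq> Q \<and> quot_lincomb s I T c = I \<longrightarrow> (\<forall>X\<in>T. c X = 0))"

text \<open>
  A splitting $A \simeq I \oplus A/I$ is given by a linear section of the projection.
\<close>

definition linear_section ::
    "('k::field \<Rightarrow> 'a::ring \<Rightarrow> 'a) \<Rightarrow> 'a set \<Rightarrow> ('a set \<Rightarrow> 'a) \<Rightarrow> bool" where
  "linear_section s I \<sigma> \<longleftrightarrow>
    (\<forall>X\<in>quot I. \<sigma> X +o I = X) \<and>
    (\<forall>X\<in>quot I. \<forall>Y\<in>quot I. \<sigma> (X + Y) = \<sigma> X + \<sigma> Y) \<and>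
    (\<forall>X\<in>quot I. \<forall>c. \<sigma> (quot_scale s I c X) = s c (\<sigma> X))"

definition subspace_basis ::
    "('k::field \<Rightarrow> 'a::ring \<Rightarrow> 'a) \<Rightarrow> 'a set \<Rightarrow> 'a set \<Rightarrow> bool" where
  "subspace_basis s I B \<longleftrightarrow> \<not> module.dependent s B \<and> module.span s B = I"


section \<open>Tensor powers\<close>

text \<open>
  \<^typ>\<open>'v list \<Rightarrow>\<^sub>0 'k\<close> is the free vector space on words over \<^typ>\<open>'v\<close>. Its quotient by the
  multilinearity relations is the tensor algebra, and the words of length \<open>m\<close> generate the
  \<open>m\<close>-th tensor power. A tensor is thus a coset of formal combinations of words.
\<close>

definition fscale :: "'k::field \<Rightarrow> ('v \<Rightarrow>\<^sub>0 'k) \<Rightarrow> ('v \<Rightarrow>\<^sub>0 'k)" where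
  "fscale c p = Poly_Mapping.map ((*) c) p"

lemma lookup_fscale [simp]: "Poly_Mapping.lookup (fscale c p) x = c * Poly_Mapping.lookup p x"
  by (simp add: fscale_def Poly_Mapping.map.rep_eq when_def)

interpretation free: vector_space fscale
  by unfold_locales (auto intro!: poly_mapping_eqI simp: lookup_add algebra_simps)

abbreviation word :: "'v list \<Rightarrow> ('v list \<Rightarrow>\<^sub>0 'k::field)" where
  "word xs \<equiv> Poly_Mapping.single xs 1"

definition multilinear_relations ::
    "'v::plus set \<Rightarrow> ('k::field \<Rightarrow> 'v \<Rightarrow> 'v) \<Rightarrow> ('v list \<Rightarrow>\<^sub>0 'k) set" where
  "multilinear_relations V s = free.span
    ({word (xs @ (x + y) # ys) - word (xs @ x # ys) - word (xs @ y # ys) | xs x y ys.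
        xs \<in> lists V \<and> x \<in> V \<and> y \<in> V \<and> ys \<in> lists V} \<union>
     {word (xs @ s c x # ys) - fscale c (word (xs @ x # ys)) | xs c x ys.
        xs \<in> lists V \<and> x \<in> V \<and> ys \<in> lists V})"

definition tensor ::
    "'v::plus set \<Rightarrow> ('k::field \<Rightarrow> 'v \<Rightarrow> 'v) \<Rightarrow> ('v list \<Rightarrow>\<^sub>0 'k) \<Rightarrow> ('v list \<Rightarrow>\<^sub>0 'k) set" where
  "tensor V s p = p +o multilinear_relations V s"

definition lin_ext :: "('v \<Rightarrow> ('w \<Rightarrow>\<^sub>0 'k::field)) \<Rightarrow> ('v \<Rightarrow>\<^sub>0 'k) \<Rightarrow> ('w \<Rightarrow>\<^sub>0 'k)" where
  "lin_ext g p = (\<Sum>x\<in>Poly_Mapping.keys p. fscale (Poly_Mapping.lookup p x) (g x))"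

lemma lin_ext_superset:
  assumes "finite S" "Poly_Mapping.keys p \<subseteq> S"
  shows "lin_ext g p = (\<Sum>x\<in>S. fscale (Poly_Mapping.lookup p x) (g x))"
  unfolding lin_ext_def using assms
  by (intro sum.mono_neutral_left) (auto simp: in_keys_iff)

lemma lin_ext_add: "lin_ext g (p + q) = lin_ext g p + lin_ext g q"
proof -
  let ?S = "Poly_Mapping.keys p \<union> Poly_Mapping.keys q"
  have "lin_ext g r = (\<Sum>x\<in>?S. fscale (Poly_Mapping.lookup r x) (g x))"
    if "r \<in> {p, q, p + q}" for r
    using that Poly_Mapping.keys_add[of p q] by (intro lin_ext_superset) auto
  then show ?thesis
    by (simp add: lookup_add free.scale_left_distrib sum.distrib)
qed

lemma lin_ext_scale: "lin_ext g (fscale c p) = fscale c (lin_ext g p)"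
proof -
  have "lin_ext g (fscale c p) =
      (\<Sum>x\<in>Poly_Mapping.keys p. fscale (Poly_Mapping.lookup (fscale c p) x) (g x))"
    by (rule lin_ext_superset) (auto simp: in_keys_iff)
  then show ?thesis
    by (simp add: lin_ext_def free.scale_sum_right)
qed

lemma lin_ext_word [simp]: "lin_ext g (Poly_Mapping.single x 1) = g x"
  by (simp add: lin_ext_def)

lemma lin_ext_diff: "lin_ext g (p - q) = lin_ext g p - lin_ext g q"
  using lin_ext_add[of g "p - q" q] by simp

lemma lin_ext_zero [simp]: "lin_ext g 0 = 0"
  by (simp add: lin_ext_def)

lemma tensor_eq_iff: "tensor V s p = tensor V s q \<longleftrightarrow> p - q \<in> multilinear_relations V s"
proof -
  have sub: "free.subspace (multilinear_relations V s)"
    unfolding multilinear_relations_def by (rule free.subspace_span)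
  have mem: "r \<in> tensor V s p \<longleftrightarrow> r - p \<in> multilinear_relations V s" for r p
    unfolding tensor_def elt_set_plus_def by (auto simp: algebra_simps) (metis add_diff_cancel_left' diff_add_cancel add.commute)
  show ?thesis
  proof
    assume "tensor V s p = tensor V s q"
    then show "p - q \<in> multilinear_relations V s"
      using mem[of p p] mem[of p q] free.subspace_0[OF sub] by simp
  next
    assume *: "p - q \<in> multilinear_relations V s"
    show "tensor V s p = tensor V s q"
      using free.subspace_add[OF sub _ *] free.subspace_diff[OF sub _ *]
      by (intro set_eqI) (force simp: mem)
  qed
qed


section \<open>The Hochschild complex\<close>

definition chains :: "'v::plus set \<Rightarrow> ('k::field \<Rightarrow> 'v \<Rightarrow> 'v) \<Rightarrow> nat \<Rightarrow> ('v list \<Rightarrow>\<^sub>0 'k) set set" where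
  "chains V s n = tensor V s ` {p. Poly_Mapping.keys p \<subseteq> {xs \<in> lists V. length xs = Suc n}}"

definition face :: "nat \<Rightarrow> 'a::times list \<Rightarrow> 'a list" where
  "face i xs = take i xs @ (xs ! i * xs ! Suc i) # drop (Suc (Suc i)) xs"

definition last_face :: "'a::times list \<Rightarrow> 'a list" where
  "last_face xs = (last xs * hd xs) # tl (butlast xs)"

text \<open>The alternating sum on \<open>C\<^sub>0\<close> is replaced by \<open>0\<close>.\<close>

definition b_word :: "'a::times list \<Rightarrow> ('a list \<Rightarrow>\<^sub>0 'k::field)" where
  "b_word xs = (if length xs \<le> 1 then 0 else
    (let n = length xs - 1 in
      (\<Sum>i<n. fscale ((-1) ^ i) (word (face i xs))) + fscale ((-1) ^ n) (word (last_face xs))))"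

text \<open>
  The next two maps are lifted to cosets by a union over all representatives, all of which give
  the same coset: see \<open>hochschild_b_tensor\<close> and \<open>proj_chain_tensor\<close> below.
\<close>

definition hochschild_b ::
    "('k::field \<Rightarrow> 'a::ring \<Rightarrow> 'a) \<Rightarrow> ('a list \<Rightarrow>\<^sub>0 'k) set \<Rightarrow> ('a list \<Rightarrow>\<^sub>0 'k) set" where
  "hochschild_b s X = (\<Union>p\<in>X. tensor UNIV s (lin_ext b_word p))"

definition proj_chain ::
    "('k::field \<Rightarrow> 'a::ring \<Rightarrow> 'a) \<Rightarrow> 'a set \<Rightarrow> ('a list \<Rightarrow>\<^sub>0 'k) set \<Rightarrow> ('a set list \<Rightarrow>\<^sub>0 'k) set" where
  "proj_chain s I X =
    (\<Union>p\<in>X. tensor (quot I) (quot_scale s I) (lin_ext (\<lambda>xs. word (map (\<lambda>a. a +o I) xs)) p))"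

definition rel_chains ::
    "('k::field \<Rightarrow> 'a::ring \<Rightarrow> 'a) \<Rightarrow> 'a set \<Rightarrow> nat \<Rightarrow> ('a list \<Rightarrow>\<^sub>0 'k) set set" where
  "rel_chains s I n =
    {X \<in> chains UNIV s n. proj_chain s I X = tensor (quot I) (quot_scale s I) 0}"

text \<open>
  The condition on the slots is \<open>i \<le> n - p\<close>, written without truncated subtraction. For
  \<open>p = 0\<close> this is the image of $C_n(I)$ in $C_n(A)$, with which $C_n(I)$ is identified (over a
  field, $I^{\otimes n+1} \to A^{\otimes n+1}$ is injective).
\<close>

definition filt_chains ::
    "('k::field \<Rightarrow> 'a::ring \<Rightarrow> 'a) \<Rightarrow> 'a set \<Rightarrow> nat \<Rightarrow> nat \<Rightarrow> ('a list \<Rightarrow>\<^sub>0 'k) set set" where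
  "filt_chains s I p n = tensor UNIV s `
    free.span {word xs | xs. length xs = Suc n \<and> (\<forall>i. i + p \<le> n \<longrightarrow> xs ! i \<in> I)}"

definition rel_filt_chains ::
    "('k::field \<Rightarrow> 'a::ring \<Rightarrow> 'a) \<Rightarrow> 'a set \<Rightarrow> nat \<Rightarrow> nat \<Rightarrow> ('a list \<Rightarrow>\<^sub>0 'k) set set" where
  "rel_filt_chains s I p n = filt_chains s I p n \<inter> rel_chains s I n"

definition rel_cycles ::
    "('k::field \<Rightarrow> 'a::ring \<Rightarrow> 'a) \<Rightarrow> 'a set \<Rightarrow> nat \<Rightarrow> ('a list \<Rightarrow>\<^sub>0 'k) set set" where
  "rel_cycles s I n = {X \<in> rel_chains s I n. hochschild_b s X = tensor UNIV s 0}"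

definition rel_boundaries ::
    "('k::field \<Rightarrow> 'a::ring \<Rightarrow> 'a) \<Rightarrow> 'a set \<Rightarrow> nat \<Rightarrow> ('a list \<Rightarrow>\<^sub>0 'k) set set" where
  "rel_boundaries s I n = hochschild_b s ` rel_chains s I (Suc n)"

text \<open>
  $HH_n(A,I)$ consists of the classes of the elements of \<open>rel_cycles s I n\<close>, as cosets of the
  boundaries.
\<close>

definition homology_class ::
    "('k::field \<Rightarrow> 'a::ring \<Rightarrow> 'a) \<Rightarrow> 'a set \<Rightarrow> nat \<Rightarrow> ('a list \<Rightarrow>\<^sub>0 'k) set \<Rightarrow> ('a list \<Rightarrow>\<^sub>0 'k) set set"
    where
  "homology_class s I n X = X +o rel_boundaries s I n"

subsection \<open>The maps on chains do not depend on representatives\<close>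

definition slot_linear :: "('k::field \<Rightarrow> 'a::ring \<Rightarrow> 'a) \<Rightarrow> ('a \<Rightarrow> 'a list) \<Rightarrow> bool" where
  "slot_linear s F \<longleftrightarrow> (\<exists>us g vs. (\<forall>z. F z = us @ g z # vs) \<and>
    (\<forall>x y. g (x + y) = g x + g y) \<and> (\<forall>c x. g (s c x) = s c (g x)))"

lemma slot_linear_context: "(\<And>z. F z = us @ z # vs) \<Longrightarrow> slot_linear s F"
  unfolding slot_linear_def
  by (intro exI[of _ us] exI[of _ "\<lambda>z. z"] exI[of _ vs]) simp

context nonunital_algebra
begin

lemma slot_linear_face:
  assumes "Suc i < length us + Suc (length vs)"
  shows "slot_linear s (\<lambda>z. face i (us @ z # vs))"
proof -
  consider "Suc i < length us" | "Suc i = length us" | "i = length us" | "i > length us"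
    by linarith
  then show ?thesis
  proof cases
    case 1
    then have "face i (us @ z # vs) =
        (take i us @ (us ! i * us ! Suc i) # drop (Suc (Suc i)) us) @ z # vs" for z
      by (simp add: face_def nth_append)
    then show ?thesis
      by (rule slot_linear_context)
  next
    case 2
    then have "face i (us @ z # vs) = take i us @ (us ! i * z) # vs" for z
      by (auto simp: face_def nth_append)
    then show ?thesis
      unfolding slot_linear_def
      by (intro exI[of _ "take i us"] exI[of _ "\<lambda>z. us ! i * z"] exI[of _ vs])
        (simp add: distrib_left scale_mult_right)
  next
    case 3
    then obtain v ws where "vs = v # ws"
      using assms by (cases vs) auto
    then have "face i (us @ z # vs) = us @ (z * v) # ws" for z
      using 3 by (simp add: face_def nth_append)
    then show ?thesis
      unfolding slot_linear_def
      by (intro exI[of _ us] exI[of _ "\<lambda>z. z * v"] exI[of _ ws])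
        (simp add: distrib_right scale_mult_left)
  next
    case 4
    define j where "j = i - Suc (length us)"
    have i: "i = Suc (length us + j)"
      using 4 by (simp add: j_def)
    have "face i (us @ z # vs) = us @ z # face j vs" for z
      by (simp add: face_def nth_append i numeral_3_eq_3)
    then show ?thesis
      by (rule slot_linear_context)
  qed
qed

lemma slot_linear_last_face:
  assumes "us \<noteq> [] \<or> vs \<noteq> []"
  shows "slot_linear s (\<lambda>z. last_face (us @ z # vs))"
proof (cases us)
  case Nil
  then have "last_face (us @ z # vs) = [] @ (last vs * z) # butlast vs" for z
    using assms by (simp add: last_face_def)
  then show ?thesis
    unfolding slot_linear_def
    by (intro exI[of _ "[]"] exI[of _ "\<lambda>z. last vs * z"] exI[of _ "butlast vs"])
      (simp add: distrib_left scale_mult_right)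
next
  case (Cons u ws)
  show ?thesis
  proof (cases "vs = []")
    case True
    then have "last_face (us @ z # vs) = [] @ (z * u) # ws" for z
      using Cons by (simp add: last_face_def butlast_append)
    then show ?thesis
      unfolding slot_linear_def
      by (intro exI[of _ "[]"] exI[of _ "\<lambda>z. z * u"] exI[of _ ws])
        (simp add: distrib_right scale_mult_left)
  next
    case False
    then have "last_face (us @ z # vs) = ((last vs * u) # ws) @ z # butlast vs" for z
      using Cons by (simp add: last_face_def butlast_append)
    then show ?thesis
      by (rule slot_linear_context)
  qed
qed

lemma slot_linear_relations:
  assumes "slot_linear s F"
  shows "word (F (x + y)) - word (F x) - word (F y) \<in> multilinear_relations UNIV s"
    and "word (F (s c x)) - fscale c (word (F x)) \<in> multilinear_relations UNIV s"
  using assms unfolding slot_linear_def multilinear_relations_def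
  by (auto intro!: free.span_base; metis)+

lemma b_word_relations:
  "b_word (us @ (x + y) # vs) - b_word (us @ x # vs) - b_word (us @ y # vs)
    \<in> multilinear_relations UNIV s" (is ?add)
  "b_word (us @ s c x # vs) - fscale c (b_word (us @ x # vs))
    \<in> multilinear_relations UNIV s" (is ?scale)
proof -
  let ?R = "multilinear_relations UNIV s"
  have sub: "free.subspace ?R"
    unfolding multilinear_relations_def by (rule free.subspace_span)
  let ?n = "length us + length vs"
  have b: "b_word (us @ z # vs) = (if ?n = 0 then 0 else
      (\<Sum>i<?n. fscale ((-1) ^ i) (word (face i (us @ z # vs)))) +
      fscale ((-1) ^ ?n) (word (last_face (us @ z # vs))))" for z
    by (auto simp: b_word_def Let_def)
  show ?add
  proof (cases "?n = 0")
    case True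
    then show ?thesis by (auto simp: b_word_def intro: free.subspace_0[OF sub])
  next
    case False
    let ?D = "\<lambda>F. word (F (x + y)) - word (F x) - word (F y)"
    have "b_word (us @ (x + y) # vs) - b_word (us @ x # vs) - b_word (us @ y # vs) =
      (\<Sum>i<?n. fscale ((-1) ^ i) (?D (\<lambda>z. face i (us @ z # vs)))) +
      fscale ((-1) ^ ?n) (?D (\<lambda>z. last_face (us @ z # vs)))"
      unfolding b if_not_P[OF False]
      by (simp only: free.scale_right_diff_distrib sum_subtractf) (simp add: algebra_simps)
    also have "\<dots> \<in> ?R"
      using False
      by (intro free.subspace_add[OF sub] free.subspace_sum[OF sub] free.subspace_scale[OF sub]
          slot_linear_relations(1) slot_linear_face slot_linear_last_face) auto
    finally show ?thesis .
  qed
  show ?scale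
  proof (cases "?n = 0")
    case True
    then show ?thesis by (auto simp: b_word_def intro: free.subspace_0[OF sub])
  next
    case False
    let ?D = "\<lambda>F. word (F (s c x)) - fscale c (word (F x))"
    have "b_word (us @ s c x # vs) - fscale c (b_word (us @ x # vs)) =
      (\<Sum>i<?n. fscale ((-1) ^ i) (?D (\<lambda>z. face i (us @ z # vs)))) +
      fscale ((-1) ^ ?n) (?D (\<lambda>z. last_face (us @ z # vs)))"
      unfolding b if_not_P[OF False]
      by (simp only: free.scale_right_diff_distrib sum_subtractf free.scale_right_distrib
          free.scale_sum_right free.scale_scale mult.commute[of c]) (simp add: algebra_simps)
    also have "\<dots> \<in> ?R"
      using False
      by (intro free.subspace_add[OF sub] free.subspace_sum[OF sub] free.subspace_scale[OF sub]
          slot_linear_relations(2) slot_linear_face slot_linear_last_face) auto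
    finally show ?thesis .
  qed
qed

end

lemma lin_ext_in_subspace:
  assumes "free.subspace R" and "\<And>r. r \<in> G \<Longrightarrow> lin_ext g r \<in> R" and "r \<in> free.span G"
  shows "lin_ext g r \<in> R"
  using assms(3)
proof (induction rule: free.span_induct_alt)
  case base
  then show ?case using assms(1) by (simp add: free.subspace_0)
next
  case (step c x y)
  then show ?case
    using assms by (simp add: lin_ext_add lin_ext_scale free.subspace_add free.subspace_scale)
qed

lemma UN_tensor:
  assumes "\<And>r. r \<in> multilinear_relations V s \<Longrightarrow> lin_ext g r \<in> multilinear_relations W t"
  shows "(\<Union>q\<in>tensor V s p. tensor W t (lin_ext g q)) = tensor W t (lin_ext g p)"
proof -
  have "tensor W t (lin_ext g q) = tensor W t (lin_ext g p)" if "q \<in> tensor V s p" for q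
    using that assms unfolding tensor_eq_iff
    by (auto simp: tensor_def elt_set_plus_def lin_ext_add)
  moreover have "p \<in> tensor V s p"
    unfolding tensor_def elt_set_plus_def multilinear_relations_def
    using free.span_zero by force
  ultimately show ?thesis by blast
qed

context nonunital_algebra
begin

lemma hochschild_b_tensor:
  "hochschild_b s (tensor UNIV s p) = tensor UNIV s (lin_ext b_word p)"
  unfolding hochschild_b_def
proof (rule UN_tensor)
  fix r assume "r \<in> multilinear_relations UNIV s"
  then show "lin_ext b_word r \<in> multilinear_relations UNIV s"
    unfolding multilinear_relations_def[of UNIV s, THEN arg_cong, of "\<lambda>R. r \<in> R"]
  proof (rule lin_ext_in_subspace[rotated 2])
    show "free.subspace (multilinear_relations UNIV s)"
      unfolding multilinear_relations_def by (rule free.subspace_span)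
  qed (auto simp: lin_ext_diff lin_ext_scale b_word_relations)
qed

lemma proj_chain_tensor:
  assumes "subspace I"
  shows "proj_chain s I (tensor UNIV s p) =
    tensor (quot I) (quot_scale s I) (lin_ext (\<lambda>xs. word (map (\<lambda>a. a +o I) xs)) p)"
  unfolding proj_chain_def
proof (rule UN_tensor)
  let ?g = "\<lambda>xs. word (map (\<lambda>a. a +o I) xs)"
  let ?R = "multilinear_relations (quot I) (quot_scale s I)"
  have I0: "0 \<in> I" and Iadd: "\<And>x y. x \<in> I \<Longrightarrow> y \<in> I \<Longrightarrow> x + y \<in> I"
    and Is: "\<And>c x. x \<in> I \<Longrightarrow> s c x \<in> I"
    using assms by (auto simp: subspace_def)
  have add: "(x + y) +o I = (x +o I) + (y +o I)" for x y
    using I0 Iadd unfolding elt_set_plus_def set_plus_def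
    by (auto simp: algebra_simps)
  have scale: "s c x +o I = quot_scale s I c (x +o I)" for c x
    using I0 Iadd Is unfolding quot_scale_def elt_set_plus_def set_plus_def
    by (auto simp: scale_right_distrib add.assoc image_iff)
  have V: "a +o I \<in> quot I" "map (\<lambda>a. a +o I) xs \<in> lists (quot I)" for a xs
    by (auto simp: quot_def)
  have *: "lin_ext ?g (word (us @ (x + y) # vs) - word (us @ x # vs) - word (us @ y # vs)) \<in> ?R"
    for us x y vs
    unfolding multilinear_relations_def lin_ext_diff lin_ext_word map_append list.map add
    by (intro free.span_base UnI1) (use V in blast)
  have **: "lin_ext ?g (word (us @ s c x # vs) - fscale c (word (us @ x # vs))) \<in> ?R"
    for us x c vs
    unfolding multilinear_relations_def lin_ext_diff lin_ext_scale lin_ext_word map_append list.map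
      scale
    by (intro free.span_base UnI2) (use V in blast)
  fix r assume "r \<in> multilinear_relations UNIV s"
  then show "lin_ext ?g r \<in> ?R"
    unfolding multilinear_relations_def[of UNIV s]
  proof (rule lin_ext_in_subspace[rotated 2])
    show "free.subspace ?R"
      unfolding multilinear_relations_def by (rule free.subspace_span)
  qed (use * ** in blast)
qed

end


section \<open>The chain $\varphi'$\<close>

text \<open>
  \<open>S\<close> is the set of indices with sign $-$, and \<^term>\<open>foldr\<close> applies $L_n$ first and $L_1$ last.
\<close>

fun L_plus :: "'a::times \<Rightarrow> 'a \<Rightarrow> 'a list \<Rightarrow> 'a list" where
  "L_plus e x (w # ws) = e # (x * w) # ws"
| "L_plus e x [] = []"

definition L_minus :: "'a::times \<Rightarrow> 'a \<Rightarrow> 'a list \<Rightarrow> 'a list" where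
  "L_minus e x ws = (x * e) # ws"

definition L_iter :: "nat \<Rightarrow> (nat \<Rightarrow> 'a::times) \<Rightarrow> (nat \<Rightarrow> 'a) \<Rightarrow> nat set \<Rightarrow> 'a list" where
  "L_iter n e f S =
    foldr (\<lambda>i. if i \<in> S then L_minus (e i) (f i) else L_plus (e i) (f i)) [1..<Suc n] [f 0]"

definition pure_prime :: "nat \<Rightarrow> (nat \<Rightarrow> 'a::times) \<Rightarrow> (nat \<Rightarrow> 'a) \<Rightarrow> ('a list \<Rightarrow>\<^sub>0 'k::field)" where
  "pure_prime n e f = (\<Sum>S\<in>Pow {1..n}. fscale ((-1) ^ card S) (word (L_iter n e f S)))"

end

theory Submission
  imports Defs
begin

text \<open>
  Let $e$ fix the first slot of every pure tensor in a chain $p$ of degree $n \ge 1$. In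
  $b(e \otimes p)$ the first face returns $p$, the middle faces give $-e$ tensored with the
  non-cyclic faces of $p$, and the last face gives the tensors $f_n e \otimes f_0 \otimes \dots
  \otimes f_{n-1}$ with the sign $(-1)^{n+1}$. If $bp = 0$, then the non-cyclic faces of $p$ add up
  to minus its cyclic face, that is, to $-(-1)^n f_n f_0 \otimes f_1 \otimes \dots \otimes f_{n-1}$
  summed over the tensors of $p$. Altogether
  \[ b(e \otimes p) = p - (-1)^{n+1} R_e\, p, \qquad
     R_e (f_0 \otimes \dots \otimes f_n)
       = e \otimes f_n f_0 \otimes f_1 \otimes \dots \otimes f_{n-1}
       - f_n e \otimes f_0 \otimes \dots \otimes f_{n-1}. \]
  So a cycle $p$ is homologous to $(-1)^{n+1} R_e\, p$. If $e \in I$ then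
  $e \otimes p$ is a relative chain, being a sum of tensors with a slot in $I$.

  The map $R_e$ removes the last slot $f_n$ and applies $L^+ - L^-$ for $e$ and $f_n$ to the rest.
  Hence $R_{e_1} \cdots R_{e_n}$ sends $\varphi_j$ to $\varphi_j'$. The choice of the $e_i$ is what
  makes the argument repeatable: after $R_{e_{i+1}}$ all first slots are $e_{i+1}$ or
  $f_{i+1} e_{i+1}$, and $e_i$ fixes both. Cycles stay cycles because $b^2 = 0$. The $n$ signs
  $(-1)^{n+1}$ multiply to $(-1)^{n(n+1)} = 1$.

  The computation is carried out with formal combinations of words. The identity for
  $b(e \otimes p)$ without the cycle condition is exact there (\<open>b_cons\<close>), as is $b^2 = 0$
  (\<open>lin_ext_b_b\<close>), whereas $bp = 0$ holds only modulo the multilinearity relations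
  (\<open>shift_homologous\<close>). The induction is \<open>partial_shifts_homologous\<close>.
\<close>


section \<open>The Hochschild differential squares to zero\<close>

text \<open>
  Including the cyclic face as the face of largest index makes $b$ a plain alternating sum and
  subjects all faces to the presimplicial identities.
\<close>

definition cface :: "nat \<Rightarrow> 'a::times list \<Rightarrow> 'a list" where
  "cface i xs = (if Suc i < length xs then face i xs else last_face xs)"

lemma length_face: "Suc i < length xs \<Longrightarrow> length (face i xs) = length xs - 1"
  by (simp add: face_def)

lemma length_last_face: "1 < length xs \<Longrightarrow> length (last_face xs) = length xs - 1"
  by (simp add: last_face_def)

lemma length_cface: "1 < length xs \<Longrightarrow> length (cface i xs) = length xs - 1"
  by (simp add: cface_def length_face length_last_face)

lemma nth_face:
  assumes "Suc i < length xs" "k < length xs - 1"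
  shows "face i xs ! k = (if k < i then xs ! k else if k = i then xs ! i * xs ! Suc i else xs ! Suc k)"
  using assms by (auto simp: face_def nth_append nth_Cons' min_def)

lemma nth_last_face:
  assumes "1 < length xs" "k < length xs - 1"
  shows "last_face xs ! k = (if k = 0 then xs ! (length xs - 1) * xs ! 0 else xs ! k)"
  using assms by (cases xs) (auto simp: last_face_def nth_Cons' nth_tl nth_butlast last_conv_nth)

text \<open>
  Two faces at cyclically adjacent places multiply the same three consecutive slots, and
  associativity makes their order irrelevant. Faces at other places do not interact.
\<close>

lemma cface_cface:
  fixes xs :: "'a::semigroup_mult list"
  assumes "3 \<le> length xs" "i < j" "j < length xs"
  shows "cface i (cface j xs) = cface (j - 1) (cface i xs)"
proof (rule nth_equalityI)
  show "length (cface i (cface j xs)) = length (cface (j - 1) (cface i xs))"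
    using assms by (simp add: length_cface)
next
  fix k assume "k < length (cface i (cface j xs))"
  then have k: "k < length xs - 2"
    using assms by (simp add: length_cface)
  obtain N where N: "length xs = Suc (Suc N)" "1 \<le> N"
    using assms by (metis Suc_le_D Suc_le_mono numeral_3_eq_3 One_nat_def)
  show "cface i (cface j xs) ! k = cface (j - 1) (cface i xs) ! k"
  proof (cases "Suc j < length xs")
    case True
    then show ?thesis
      using assms k by (auto simp: cface_def nth_face length_face mult.assoc)
  next
    case False
    then have "j = Suc N"
      using assms N by simp
    then show ?thesis
      using assms k N
      by (cases "i = N")
        (auto simp: cface_def nth_face nth_last_face length_face length_last_face mult.assoc)
  qed
qed

text \<open>
  The standard cancellation: the term at \<open>(j, i)\<close> with \<open>i < j\<close> is the negative of the term at
  \<open>(i, j - 1)\<close>, and this pairs the terms above the diagonal with the other ones.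
\<close>

lemma alternating_face_sum_zero:
  fixes D :: "nat \<Rightarrow> nat \<Rightarrow> ('v \<Rightarrow>\<^sub>0 'k::field)"
  assumes "\<And>i j. i < j \<Longrightarrow> j \<le> N \<Longrightarrow> D i j = D (j - 1) i"
  shows "(\<Sum>j<Suc N. \<Sum>i<N. fscale ((-1) ^ (i + j)) (D i j)) = 0"
proof -
  let ?t = "\<lambda>(j, i). fscale ((-1) ^ (i + j)) (D i j)"
  let ?U = "{(j, i). i < j \<and> j < Suc N}" and ?L = "{(j, i). j \<le> i \<and> i < N}"
  have fin: "finite ?U" "finite ?L"
    by (rule finite_subset[of _ "{..N} \<times> {..N}"]; auto)+
  have "(\<Sum>j<Suc N. \<Sum>i<N. fscale ((-1) ^ (i + j)) (D i j)) = sum ?t ({..<Suc N} \<times> {..<N})"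
    by (simp add: sum.cartesian_product)
  also have "{..<Suc N} \<times> {..<N} = ?U \<union> ?L"
    by auto
  also have "sum ?t (?U \<union> ?L) = sum ?t ?U + sum ?t ?L"
    using fin by (intro sum.union_disjoint) auto
  also have "sum ?t ?L = (\<Sum>x\<in>?U. - ?t x)"
  proof (rule sum.reindex_bij_witness[where i = "\<lambda>(j, i). (i, j - 1)"
        and j = "\<lambda>(j, i). (Suc i, j)"])
    fix x assume "x \<in> ?L"
    then obtain j i where x: "x = (j, i)" "j \<le> i" "i < N"
      by auto
    then have "D j (Suc i) = D i j"
      using assms[of j "Suc i"] by simp
    then show "- ?t (case x of (j, i) \<Rightarrow> (Suc i, j)) = ?t x"
      using x by (simp add: add.commute free.scale_minus_left)
  qed auto
  finally show ?thesis
    by (simp add: sum_negf)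
qed

lemma b_word_cface:
  assumes "1 < length xs"
  shows "b_word xs = (\<Sum>i<length xs. fscale ((-1) ^ i) (word (cface i xs)))"
proof -
  obtain n where n: "length xs = Suc n" "0 < n"
    using assms by (cases "length xs") auto
  then show ?thesis
    by (simp add: b_word_def cface_def)
qed

lemma lin_ext_sum: "lin_ext g (sum h A) = (\<Sum>x\<in>A. lin_ext g (h x))"
  by (induction A rule: infinite_finite_induct) (simp_all add: lin_ext_add)

lemma lin_ext_b_b_word:
  fixes xs :: "'a::ring list"
  shows "lin_ext b_word (b_word xs) = (0 :: 'a list \<Rightarrow>\<^sub>0 'k::field)"
proof (cases "length xs \<le> 2")
  case True
  (* On words of length 1 the differential is zero by definition, not as an alternating sum. *)
  show ?thesis
  proof (cases "length xs \<le> 1")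
    case False
    have "length (cface i xs) \<le> 1" for i
      using True False by (simp add: length_cface)
    then have "b_word (cface i xs) = (0 :: 'a list \<Rightarrow>\<^sub>0 'k)" for i
      by (simp only: b_word_def if_True)
    with False show ?thesis
      by (simp add: b_word_cface lin_ext_sum lin_ext_scale)
  qed (simp add: b_word_def)
next
  case False
  then obtain N where N: "length xs = Suc N" "2 \<le> N"
    by (cases "length xs") auto
  have "lin_ext b_word (b_word xs) = (\<Sum>j<Suc N. \<Sum>i<N.
      fscale ((-1) ^ (i + j)) (word (cface i (cface j xs))) :: 'a list \<Rightarrow>\<^sub>0 'k)"
    using N
    by (simp add: b_word_cface lin_ext_sum lin_ext_scale length_cface free.scale_sum_right
        power_add mult.commute del: sum.lessThan_Suc)
  also have "\<dots> = 0"
    using N by (intro alternating_face_sum_zero arg_cong[of _ _ word] cface_cface) auto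
  finally show ?thesis .
qed

lemma lin_ext_b_b: "lin_ext b_word (lin_ext b_word p) = 0"
  for p :: "'a::ring list \<Rightarrow>\<^sub>0 'k::field"
  unfolding lin_ext_def[of b_word p] lin_ext_sum by (simp add: lin_ext_scale lin_ext_b_b_word)


section \<open>Prepending a left unit\<close>

text \<open>
  This is $R_e$. The slot $f_i$ that $L_i^{\pm}$ uses is read off the end of the word, so one linear
  map applies to all summands of a chain, although $L_i^{\pm}$ depends on the summand.
\<close>

definition shift_word :: "'a::times \<Rightarrow> 'a list \<Rightarrow> ('a list \<Rightarrow>\<^sub>0 'k::field)" where
  "shift_word e w = word (L_plus e (last w) (butlast w)) - word (L_minus e (last w) (butlast w))"

text \<open>
  The unit \<open>e\<close> makes the zeroth face of \<open>e # w\<close> equal to \<open>w\<close>. The other faces, except the last,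
  are \<open>e\<close> prepended to the faces of \<open>w\<close>; to complete these to the differential of \<open>w\<close> one has
  to add and subtract \<open>e\<close> prepended to the cyclic face of \<open>w\<close>, which is the $L^+$ term of the shift.
\<close>

lemma b_word_Cons:
  fixes w :: "'a::ring list"
  assumes w: "length w = Suc n" "1 \<le> n" and e: "e * hd w = hd w"
  shows "b_word (e # w) = word w - lin_ext (\<lambda>u. word (e # u)) (b_word w)
    + fscale ((-1) ^ n) (shift_word e w :: 'a list \<Rightarrow>\<^sub>0 'k::field)"
proof -
  let ?c = "\<lambda>u. word (e # u) :: 'a list \<Rightarrow>\<^sub>0 'k"
  have f0: "face 0 (e # w) = w"
    using w e by (cases w) (auto simp: face_def)
  have f_Suc: "face (Suc i) (e # w) = e # face i w" for i
    by (simp add: face_def)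
  have lm: "last_face (e # w) = L_minus e (last w) (butlast w)"
    using w by (auto simp: last_face_def L_minus_def)
  have lp: "e # last_face w = L_plus e (last w) (butlast w)"
  proof -
    from w obtain x y ys where "w = x # y # ys"
      by (cases w; cases "tl w") auto
    then show ?thesis
      by (simp add: last_face_def)
  qed
  have "b_word (e # w) = (\<Sum>i<Suc n. fscale ((-1) ^ i) (word (face i (e # w))))
      + fscale ((-1) ^ Suc n) (word (last_face (e # w)) :: 'a list \<Rightarrow>\<^sub>0 'k)"
    using w by (simp add: b_word_def)
  also have "\<dots> = word w - (\<Sum>i<n. fscale ((-1) ^ i) (?c (face i w)))
      - fscale ((-1) ^ n) (word (L_minus e (last w) (butlast w)))"
    by (simp add: sum.lessThan_Suc_shift f0 f_Suc lm sum_negf del: sum.lessThan_Suc)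
  also have "(\<Sum>i<n. fscale ((-1) ^ i) (?c (face i w)))
      = lin_ext ?c (b_word w) - fscale ((-1) ^ n) (word (L_plus e (last w) (butlast w)))"
    using w by (simp add: b_word_def Let_def lin_ext_add lin_ext_sum lin_ext_scale lp)
  finally show ?thesis
    by (simp add: shift_word_def free.scale_right_diff_distrib)
qed

lemma subspace_relations: "free.subspace (multilinear_relations V s)"
  unfolding multilinear_relations_def by (rule free.subspace_span)

lemma linear_zero_on_span:
  assumes "p \<in> free.span G"
    and "\<And>r q. D (r + q) = D r + D q" and "\<And>c r. D (fscale c r) = fscale c (D r)"
    and "\<And>r. r \<in> G \<Longrightarrow> D r = 0"
  shows "D p = (0 :: 'w \<Rightarrow>\<^sub>0 'k::field)"
  using assms(1)
proof (induction rule: free.span_induct_alt)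
  case base
  show ?case using assms(2)[of 0 0] by simp
qed (simp add: assms)

lemma b_cons:
  fixes p :: "'a::ring list \<Rightarrow>\<^sub>0 'k::field"
  assumes n: "1 \<le> n"
    and p: "p \<in> free.span {word w | w. length w = Suc n \<and> e * hd w = hd w}"
  shows "lin_ext b_word (lin_ext (\<lambda>u. word (e # u)) p)
    = p - lin_ext (\<lambda>u. word (e # u)) (lin_ext b_word p)
      + fscale ((-1) ^ n) (lin_ext (shift_word e) p)"
proof -
  let ?c = "lin_ext (\<lambda>u. word (e # u)) :: ('a list \<Rightarrow>\<^sub>0 'k) \<Rightarrow> _"
  let ?D = "\<lambda>p. lin_ext b_word (?c p)
    - (p - ?c (lin_ext b_word p) + fscale ((-1) ^ n) (lin_ext (shift_word e) p))"
  have "?D p = 0"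
  proof (rule linear_zero_on_span[OF p])
    fix r q :: "'a list \<Rightarrow>\<^sub>0 'k" and c
    show "?D (r + q) = ?D r + ?D q"
      by (simp add: lin_ext_add free.scale_right_distrib)
    show "?D (fscale c r) = fscale c (?D r)"
      by (simp add: lin_ext_scale free.scale_right_distrib free.scale_right_diff_distrib
          mult.commute)
  next
    fix r :: "'a list \<Rightarrow>\<^sub>0 'k"
    assume "r \<in> {word w | w. length w = Suc n \<and> e * hd w = hd w}"
    then obtain w where "r = word w" "length w = Suc n" "e * hd w = hd w"
      by blast
    then show "?D r = 0"
      using b_word_Cons[of w n e] n by simp
  qed
  then show ?thesis
    by simp
qed

text \<open>Up to multilinearity, these combinations of words represent $F_nC_n(A,I)$.\<close>

definition first_slot_chains :: "'a set \<Rightarrow> nat \<Rightarrow> ('a list \<Rightarrow>\<^sub>0 'k::field) set" where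
  "first_slot_chains I n = free.span {word w | w. length w = Suc n \<and> hd w \<in> I}"

lemma subspace_first_slot_chains: "free.subspace (first_slot_chains I n)"
  unfolding first_slot_chains_def by (rule free.subspace_span)

lemma cons_first_slot_chains:
  assumes "p \<in> free.span {word w | w. length w = Suc n \<and> Q w}" "e \<in> I"
  shows "lin_ext (\<lambda>u. word (e # u)) p \<in> first_slot_chains I (Suc n)"
  using subspace_first_slot_chains _ assms(1)
proof (rule lin_ext_in_subspace)
  fix r :: "'a list \<Rightarrow>\<^sub>0 'b"
  assume "r \<in> {word w | w. length w = Suc n \<and> Q w}"
  then show "lin_ext (\<lambda>u. word (e # u)) r \<in> first_slot_chains I (Suc n)"
    using assms(2) unfolding first_slot_chains_def by (auto intro!: free.span_base)
qed

context nonunital_algebra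
begin

lemma b_relations:
  assumes "r \<in> multilinear_relations UNIV s"
  shows "lin_ext b_word r \<in> multilinear_relations UNIV s"
  using hochschild_b_tensor[of 0] hochschild_b_tensor[of r] assms
  by (metis diff_zero lin_ext_zero tensor_eq_iff)

lemma cons_relations:
  assumes "r \<in> multilinear_relations UNIV s"
  shows "lin_ext (\<lambda>u. word (e # u)) r \<in> multilinear_relations UNIV s"
  using subspace_relations _ assms[unfolded multilinear_relations_def]
proof (rule lin_ext_in_subspace)
  fix r :: "'a list \<Rightarrow>\<^sub>0 'k"
  assume "r \<in> {word (xs @ (x + y) # ys) - word (xs @ x # ys) - word (xs @ y # ys) | xs x y ys.
        xs \<in> lists UNIV \<and> x \<in> UNIV \<and> y \<in> UNIV \<and> ys \<in> lists UNIV} \<union>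
     {word (xs @ s c x # ys) - fscale c (word (xs @ x # ys)) | xs c x ys.
        xs \<in> lists UNIV \<and> x \<in> UNIV \<and> ys \<in> lists UNIV}"
  then show "lin_ext (\<lambda>u. word (e # u)) r \<in> multilinear_relations UNIV s"
    using slot_linear_relations[OF slot_linear_context[of _ "e # us" vs for us vs]]
    by (auto simp: lin_ext_diff lin_ext_scale)
qed

text \<open>
  The term $e \otimes bp$ in \<open>b_cons\<close> is a multilinearity relation when $bp$ is one.
\<close>

lemma shift_homologous:
  assumes "1 \<le> n" "p \<in> free.span {word w | w. length w = Suc n \<and> e * hd w = hd w}"
    and "lin_ext b_word p \<in> multilinear_relations UNIV s"
  shows "p - fscale ((-1) ^ Suc n) (lin_ext (shift_word e) p)
      - lin_ext b_word (lin_ext (\<lambda>u. word (e # u)) p) \<in> multilinear_relations UNIV s"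
  using cons_relations[OF assms(3)] by (simp add: b_cons[OF assms(1,2)])

lemma cycle_if_homologous:
  assumes "lin_ext b_word p \<in> multilinear_relations UNIV s"
    and "p - q - lin_ext b_word r \<in> multilinear_relations UNIV s"
  shows "lin_ext b_word q \<in> multilinear_relations UNIV s"
  using free.subspace_diff[OF subspace_relations assms(1) b_relations[OF assms(2)]]
  by (simp add: lin_ext_diff lin_ext_b_b)

end


section \<open>Iterating the shift\<close>

text \<open>
  $L_{m+1}^{\pm} \cdots L_n^{\pm}(f_0)$, with sign $-$ at the indices in \<open>S\<close>; the word after
  \<open>n - m\<close> of the \<open>n\<close> steps from $f_0$ to $L_1^{\pm} \cdots L_n^{\pm}(f_0)$.
\<close>

definition tail_iter :: "nat \<Rightarrow> (nat \<Rightarrow> 'a::times) \<Rightarrow> (nat \<Rightarrow> 'a) \<Rightarrow> nat set \<Rightarrow> nat \<Rightarrow> 'a list" where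
  "tail_iter n e f S m =
    foldr (\<lambda>i. if i \<in> S then L_minus (e i) (f i) else L_plus (e i) (f i)) [Suc m..<Suc n] [f 0]"

lemma tail_iter_refl: "tail_iter n e f S n = [f 0]"
  by (simp add: tail_iter_def)

lemma tail_iter_Suc:
  "m < n \<Longrightarrow> tail_iter n e f S m = (if Suc m \<in> S then L_minus (e (Suc m)) (f (Suc m))
    else L_plus (e (Suc m)) (f (Suc m))) (tail_iter n e f S (Suc m))"
  by (simp add: tail_iter_def upt_conv_Cons del: upt_Suc)

lemma tail_iter_0: "tail_iter n e f S 0 = L_iter n e f S"
  by (simp add: tail_iter_def L_iter_def)

lemma tail_iter_cong:
  "(\<And>i. m < i \<Longrightarrow> i \<le> n \<Longrightarrow> i \<in> S \<longleftrightarrow> i \<in> S') \<Longrightarrow> tail_iter n e f S m = tail_iter n e f S' m"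
  unfolding tail_iter_def by (intro foldr_cong) auto

lemma length_L_plus [simp]: "w \<noteq> [] \<Longrightarrow> length (L_plus e x w) = Suc (length w)"
  by (cases w) auto

lemma length_tail_iter: "m \<le> n \<Longrightarrow> length (tail_iter n e f S m) = Suc (n - m)"
proof (induction rule: inc_induct)
  case base
  show ?case by (simp add: tail_iter_refl)
next
  case (step m)
  then have "tail_iter n e f S (Suc m) \<noteq> []"
    by force
  then show ?case using step by (simp add: tail_iter_Suc L_minus_def)
qed

lemma tail_iter_nonempty: "m \<le> n \<Longrightarrow> tail_iter n e f S m \<noteq> []"
  using length_tail_iter[of m n e f S] by force

text \<open>
  These two values are what the next left unit has to fix: they are the set for which $e_m$ is chosen.
\<close>

lemma hd_tail_iter:
  assumes "m < n"
  shows "hd (tail_iter n e f S m) \<in> {e (Suc m), f (Suc m) * e (Suc m)}"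
  using tail_iter_nonempty[of "Suc m" n e f S] assms
  by (cases "tail_iter n e f S (Suc m)") (auto simp: tail_iter_Suc L_minus_def)

lemma set_tail_iter:
  assumes "m \<le> n" "f 0 \<in> I" "\<And>i. 1 \<le> i \<Longrightarrow> i \<le> n \<Longrightarrow> e i \<in> I" "\<And>a x. x \<in> I \<Longrightarrow> a * x \<in> I"
  shows "set (tail_iter n e f S m) \<subseteq> I"
  using assms(1)
proof (induction rule: inc_induct)
  case base
  then show ?case using assms by (simp add: tail_iter_refl)
next
  case (step m)
  then show ?case
    using assms tail_iter_nonempty[of "Suc m" n e f S]
    by (cases "tail_iter n e f S (Suc m)") (auto simp: tail_iter_Suc L_minus_def)
qed

text \<open>
  This is $R_{e_{m+1}} \cdots R_{e_n}$ applied to $f_0 \otimes \dots \otimes f_n$: the slots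
  $f_n, \dots, f_{m+1}$ have been used up and $f_1, \dots, f_m$ are still in place at the end.
\<close>

definition partial_shift :: "nat \<Rightarrow> (nat \<Rightarrow> 'a::times) \<Rightarrow> (nat \<Rightarrow> 'a) \<Rightarrow> nat \<Rightarrow> ('a list \<Rightarrow>\<^sub>0 'k::field)" where
  "partial_shift n e f m = (\<Sum>S\<in>Pow {Suc m..n}.
    fscale ((-1) ^ card S) (word (tail_iter n e f S m @ map f [1..<Suc m])))"

lemma partial_shift_start: "partial_shift n e f n = word (map f [0..<Suc n])"
  by (simp add: partial_shift_def tail_iter_refl upt_conv_Cons[of 0 "Suc n"] del: upt_Suc)

lemma partial_shift_end: "partial_shift n e f 0 = pure_prime n e f"
  by (simp add: partial_shift_def pure_prime_def tail_iter_0)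

lemma L_plus_append: "w \<noteq> [] \<Longrightarrow> L_plus e x (w @ v) = L_plus e x w @ v"
  by (cases w) auto

text \<open>
  The two terms of the shift correspond to the two ways of extending a set of signs for the indices
  above \<open>Suc m\<close> to the index \<open>Suc m\<close>.
\<close>

lemma shift_word_partial_shift:
  assumes m: "m < n"
  shows "lin_ext (shift_word (e (Suc m))) (partial_shift n e f (Suc m)) = partial_shift n e f m"
proof -
  let ?T = "\<lambda>S. tail_iter n e f S (Suc m)" and ?v = "map f [1..<Suc m]"
  let ?t = "\<lambda>S. fscale ((-1) ^ card S) (word (tail_iter n e f S m @ ?v))"
  let ?P = "Pow {Suc (Suc m)..n}"
  have sh: "shift_word (e (Suc m)) (?T S @ map f [1..<Suc (Suc m)])
      = word (L_plus (e (Suc m)) (f (Suc m)) (?T S) @ ?v)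
      - word (L_minus (e (Suc m)) (f (Suc m)) (?T S) @ ?v)" for S
    using tail_iter_nonempty[of "Suc m" n e f S] m
    by (simp add: shift_word_def L_plus_append L_minus_def butlast_append)
  have plus: "?t S = fscale ((-1) ^ card S) (word (L_plus (e (Suc m)) (f (Suc m)) (?T S) @ ?v))"
    if "S \<in> ?P" for S
    using that m by (auto simp: tail_iter_Suc)
  have minus: "?t (insert (Suc m) S)
      = - fscale ((-1) ^ card S) (word (L_minus (e (Suc m)) (f (Suc m)) (?T S) @ ?v))"
    if "S \<in> ?P" for S
  proof -
    have "Suc m \<notin> S" "finite S"
      using that finite_subset[of S "{Suc (Suc m)..n}"] by auto
    moreover have "tail_iter n e f (insert (Suc m) S) (Suc m) = ?T S"
      by (rule tail_iter_cong) auto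
    ultimately show ?thesis
      using m by (simp add: tail_iter_Suc free.scale_minus_left)
  qed
  have "{Suc m..n} = insert (Suc m) {Suc (Suc m)..n}"
    using m by auto
  then have "partial_shift n e f m = sum ?t (?P \<union> insert (Suc m) ` ?P)"
    by (simp add: partial_shift_def Pow_insert)
  also have "\<dots> = sum ?t ?P + sum ?t (insert (Suc m) ` ?P)"
    by (intro sum.union_disjoint) auto
  also have "sum ?t (insert (Suc m) ` ?P) = (\<Sum>S\<in>?P. ?t (insert (Suc m) S))"
  proof -
    have "inj_on (insert (Suc m)) ?P"
      by (rule inj_onI) (auto simp: insert_eq_iff dest!: insert_ident[THEN iffD1, rotated 2])
    then show ?thesis
      by (simp add: sum.reindex)
  qed
  also have "sum ?t ?P + (\<Sum>S\<in>?P. ?t (insert (Suc m) S))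
      = (\<Sum>S\<in>?P. fscale ((-1) ^ card S) (shift_word (e (Suc m)) (?T S @ map f [1..<Suc (Suc m)])))"
    unfolding sum.distrib[symmetric]
    by (intro sum.cong refl)
      (simp only: plus minus sh free.scale_right_diff_distrib add_uminus_conv_diff)
  finally have expansion: "partial_shift n e f m = (\<Sum>S\<in>?P. fscale ((-1) ^ card S)
      (shift_word (e (Suc m)) (?T S @ map f [1..<Suc (Suc m)])))" .
  show ?thesis
    unfolding expansion by (simp add: partial_shift_def lin_ext_sum lin_ext_scale del: upt_Suc)
qed

lemma partial_shift_in_span:
  assumes "m \<le> n" "\<And>S. Q (tail_iter n e f S m @ map f [1..<Suc m])"
  shows "partial_shift n e f m \<in> free.span {word w | w. length w = Suc n \<and> Q w}"
  unfolding partial_shift_def using assms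
  by (intro free.span_sum free.span_scale free.span_base)
    (auto simp: length_tail_iter simp del: upt_Suc)

context nonunital_algebra
begin

text \<open>
  The boundary witness of the step from \<open>Suc m\<close> to \<open>m\<close> is the chain at \<open>Suc m\<close> with
  \<open>e (Suc m)\<close> prepended. That chain is a cycle, since it is homologous to the one at \<open>n\<close> up to
  sign.
\<close>

lemma partial_shifts_homologous:
  fixes J :: "'j set" and lam :: "'j \<Rightarrow> 'k" and f :: "'j \<Rightarrow> nat \<Rightarrow> 'a"
    and e :: "nat \<Rightarrow> 'a" and n :: nat
  defines "P \<equiv> \<lambda>m. \<Sum>j\<in>J. fscale (lam j) (partial_shift n e (f j) m)"
  assumes n: "1 \<le> n" and m: "m \<le> n"
    and e: "\<And>i. 1 \<le> i \<Longrightarrow> i \<le> n \<Longrightarrow> e i \<in> I"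
    and e_last: "\<And>j. j \<in> J \<Longrightarrow> e n * f j 0 = f j 0"
    and e_step: "\<And>i j. 1 \<le> i \<Longrightarrow> i < n \<Longrightarrow> j \<in> J \<Longrightarrow>
      e i * e (Suc i) = e (Suc i) \<and> e i * (f j (Suc i) * e (Suc i)) = f j (Suc i) * e (Suc i)"
    and cycle: "lin_ext b_word (P n) \<in> multilinear_relations UNIV s"
  shows "\<exists>r\<in>first_slot_chains I (Suc n). P n - fscale (((-1) ^ Suc n) ^ (n - m)) (P m)
    - lin_ext b_word r \<in> multilinear_relations UNIV s"
  using m
proof (induction rule: inc_induct)
  case base
  show ?case
    using free.subspace_0[OF subspace_first_slot_chains] free.subspace_0[OF subspace_relations]
    by (intro bexI[of _ 0]) auto
next
  case (step m)
  let ?R = "multilinear_relations UNIV s :: ('a list \<Rightarrow>\<^sub>0 'k) set"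
  let ?d = "((-1) ^ Suc n) ^ (n - Suc m) :: 'k"
  let ?r' = "lin_ext (\<lambda>u. word (e (Suc m) # u)) (P (Suc m))"
  obtain r where r: "r \<in> first_slot_chains I (Suc n)"
    and Pr: "P n - fscale ?d (P (Suc m)) - lin_ext b_word r \<in> ?R"
    using step.IH by blast
  (* The sign is its own inverse, so it can be removed from a multiple that is known to be a cycle. *)
  have dd: "?d * ?d = 1"
    by (simp flip: power_mult_distrib)
  have "lin_ext b_word (fscale ?d (P (Suc m))) \<in> ?R"
    by (rule cycle_if_homologous[OF cycle Pr])
  then have "fscale ?d (lin_ext b_word (fscale ?d (P (Suc m)))) \<in> ?R"
    by (rule free.subspace_scale[OF subspace_relations])
  then have cyc: "lin_ext b_word (P (Suc m)) \<in> ?R"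
    using dd by (simp only: lin_ext_scale free.scale_scale free.scale_one)
  have span: "P (Suc m) \<in> free.span {word w | w. length w = Suc n \<and> e (Suc m) * hd w = hd w}"
    unfolding P_def
  proof (intro free.span_sum free.span_scale partial_shift_in_span)
    fix j S assume j: "j \<in> J"
    have "hd (tail_iter n e (f j) S (Suc m)) \<in>
        (if Suc m = n then {f j 0} else {e (Suc (Suc m)), f j (Suc (Suc m)) * e (Suc (Suc m))})"
      using hd_tail_iter[of "Suc m" n e "f j" S] step.hyps by (auto simp: tail_iter_refl)
    then have "e (Suc m) * hd (tail_iter n e (f j) S (Suc m)) = hd (tail_iter n e (f j) S (Suc m))"
      using e_last[OF j] e_step[of "Suc m" j] j step.hyps by (auto split: if_splits)
    then show "e (Suc m) * hd (tail_iter n e (f j) S (Suc m) @ map (f j) [1..<Suc (Suc m)])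
        = hd (tail_iter n e (f j) S (Suc m) @ map (f j) [1..<Suc (Suc m)])"
      using tail_iter_nonempty[of "Suc m" n e "f j" S] step.hyps by simp
  qed (use step.hyps in simp)
  have shift: "lin_ext (shift_word (e (Suc m))) (P (Suc m)) = P m"
    using step.hyps by (simp add: P_def lin_ext_sum lin_ext_scale shift_word_partial_shift)
  have "P (Suc m) - fscale ((-1) ^ Suc n) (P m) - lin_ext b_word ?r' \<in> ?R"
    using shift_homologous[OF n span cyc] by (simp only: shift)
  from free.subspace_add[OF subspace_relations Pr
      free.subspace_scale[OF subspace_relations this, of ?d]]
  have "P n - fscale (?d * (-1) ^ Suc n) (P m) - lin_ext b_word (r + fscale ?d ?r') \<in> ?R"
    by (simp add: lin_ext_add lin_ext_scale free.scale_right_diff_distrib algebra_simps del: power_Suc)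
  moreover have "?d * (-1) ^ Suc n = ((-1) ^ Suc n) ^ (n - m)"
    using step.hyps by (simp add: Suc_diff_Suc[symmetric] mult.commute del: power_Suc flip: power_Suc)
  moreover have "r + fscale ?d ?r' \<in> first_slot_chains I (Suc n)"
    using r cons_first_slot_chains[OF span] e step.hyps
    by (intro free.subspace_add free.subspace_scale subspace_first_slot_chains) auto
  ultimately show ?case
    by (metis (no_types, lifting))
qed

end


section \<open>Relative chains and homology classes as cosets\<close>

lemma set_plus_self:
  fixes A :: "'v::comm_monoid_add set"
  assumes "0 \<in> A" "\<And>x y. x \<in> A \<Longrightarrow> y \<in> A \<Longrightarrow> x + y \<in> A"
  shows "A + A = A"
proof
  show "A + A \<subseteq> A"
    using assms(2) by (auto elim: set_plus_elim)
  show "A \<subseteq> A + A"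
    using set_plus_intro[OF assms(1), of _ A] by auto
qed

context nonunital_algebra
begin

lemma mem_rel_chains_iff:
  assumes "subspace I"
  shows "tensor UNIV s p \<in> rel_chains s I n \<longleftrightarrow> tensor UNIV s p \<in> chains UNIV s n \<and>
    lin_ext (\<lambda>xs. word (map (\<lambda>a. a +o I) xs)) p \<in> multilinear_relations (quot I) (quot_scale s I)"
  by (simp add: rel_chains_def proj_chain_tensor[OF assms] tensor_eq_iff)

lemma rel_chains_diff:
  assumes "subspace I"
    and "tensor UNIV s p \<in> rel_chains s I n" "tensor UNIV s q \<in> rel_chains s I n"
  shows "tensor UNIV s (p - q) \<in> rel_chains s I n"
proof -
  have "tensor UNIV s (p - q) \<in> chains UNIV s n"
  proof -
    from assms obtain p' q' where p': "tensor UNIV s p = tensor UNIV s p'"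
        "Poly_Mapping.keys p' \<subseteq> {xs \<in> lists UNIV. length xs = Suc n}"
      and q': "tensor UNIV s q = tensor UNIV s q'"
        "Poly_Mapping.keys q' \<subseteq> {xs \<in> lists UNIV. length xs = Suc n}"
      unfolding rel_chains_def chains_def by blast
    have "(p - p') - (q - q') \<in> multilinear_relations UNIV s"
      using p'(1) q'(1) by (simp add: tensor_eq_iff free.subspace_diff[OF subspace_relations])
    then have "tensor UNIV s (p - q) = tensor UNIV s (p' - q')"
      by (simp add: tensor_eq_iff algebra_simps)
    moreover have "Poly_Mapping.keys (p' - q') \<subseteq> {xs \<in> lists UNIV. length xs = Suc n}"
      using p'(2) q'(2) keys_diff[of p' q'] by blast
    ultimately show ?thesis
      unfolding chains_def by blast
  qed
  then show ?thesis
    using assms(2,3) unfolding mem_rel_chains_iff[OF assms(1)] lin_ext_diff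
    by (blast intro: free.subspace_diff[OF subspace_relations])
qed

text \<open>
  A slot in \<open>I\<close> becomes the zero coset \<open>I\<close> of the quotient. A word containing it is a
  multilinearity relation because of $I + I = I$: additivity in that slot reads $w = w + w$.
\<close>

lemma first_slot_chains_rel_chains:
  assumes I: "subspace I" and p: "p \<in> first_slot_chains I n"
  shows "tensor UNIV s p \<in> rel_chains s I n"
  unfolding mem_rel_chains_iff[OF I]
proof
  let ?C = "{q :: 'a list \<Rightarrow>\<^sub>0 'k. Poly_Mapping.keys q \<subseteq> {xs \<in> lists UNIV. length xs = Suc n}}"
  have "free.subspace ?C"
    unfolding free.subspace_def
  proof (intro conjI ballI allI)
    fix q q' :: "'a list \<Rightarrow>\<^sub>0 'k"
    assume "q \<in> ?C"
      "q' \<in> ?C"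
    then show "q + q' \<in> ?C"
      using Poly_Mapping.keys_add[of q q'] by blast
  qed (auto simp: in_keys_iff)
  then have "first_slot_chains I n \<subseteq> ?C"
    unfolding first_slot_chains_def by (intro free.span_minimal) auto
  with p show "tensor UNIV s p \<in> chains UNIV s n"
    unfolding chains_def by blast
next
  let ?R = "multilinear_relations (quot I) (quot_scale s I)"
  show "lin_ext (\<lambda>xs. word (map (\<lambda>a. a +o I) xs)) p \<in> ?R"
    using subspace_relations _ p[unfolded first_slot_chains_def]
  proof (rule lin_ext_in_subspace)
    fix r :: "'a list \<Rightarrow>\<^sub>0 'k"
    assume "r \<in> {word w | w. length w = Suc n \<and> hd w \<in> I}"
    then obtain x ys where r: "r = word (x # ys)" "x \<in> I"
      by (auto simp: length_Suc_conv)
    let ?ys = "map (\<lambda>a. a +o I) ys"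
    have coset: "x +o I = I"
    proof
      show "x +o I \<subseteq> I"
        using subspace_add[OF I r(2)] by (auto simp: elt_set_plus_def)
      show "I \<subseteq> x +o I"
        using subspace_diff[OF I _ r(2)] by (auto simp: set_minus_plus[symmetric])
    qed
    have II: "I + I = I"
      using I by (intro set_plus_self) (auto simp: subspace_def)
    have "I \<in> quot I" "?ys \<in> lists (quot I)"
      using coset by (auto simp: quot_def)
    then have "word ([] @ (I + I) # ?ys) - word ([] @ I # ?ys) - word ([] @ I # ?ys) \<in> ?R"
      unfolding multilinear_relations_def by (intro free.span_base UnI1) blast
    then have "- word (I # ?ys) \<in> ?R"
      by (simp add: II)
    then show "lin_ext (\<lambda>xs. word (map (\<lambda>a. a +o I) xs)) r \<in> ?R"
      using free.subspace_neg[OF subspace_relations, of "- word (I # ?ys)"] by (simp add: r coset)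
  qed
qed

lemma tensor_add: "tensor UNIV s p + tensor UNIV s q = tensor UNIV s (p + q)"
proof -
  let ?R = "multilinear_relations UNIV s :: ('a list \<Rightarrow>\<^sub>0 'k) set"
  have "?R + ?R = ?R"
    by (intro set_plus_self free.subspace_0 free.subspace_add subspace_relations)
  then show ?thesis
    by (simp add: tensor_def set_plus_rearrange)
qed

text \<open>
  A class consists of the sums of a fixed representative with all boundaries. Changing the representative from \<open>q\<close> to
  \<open>p\<close> is absorbed by replacing the bounding chain \<open>t\<close> with \<open>t - r\<close>.
\<close>

lemma homology_class_subset:
  assumes I: "subspace I" and r: "tensor UNIV s r \<in> rel_chains s I (Suc n)"
    and pq: "p - q - lin_ext b_word r \<in> multilinear_relations UNIV s"
  shows "homology_class s I n (tensor UNIV s q) \<subseteq> homology_class s I n (tensor UNIV s p)"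
proof
  fix X assume "X \<in> homology_class s I n (tensor UNIV s q)"
  then obtain Y where X: "X = tensor UNIV s q + hochschild_b s Y"
    and Y: "Y \<in> rel_chains s I (Suc n)"
    unfolding homology_class_def rel_boundaries_def elt_set_plus_def by blast
  then obtain t where t: "Y = tensor UNIV s t"
    unfolding rel_chains_def chains_def by blast
  have "X = tensor UNIV s (q + lin_ext b_word t)"
    by (simp add: X t hochschild_b_tensor tensor_add)
  also have "\<dots> = tensor UNIV s (p + lin_ext b_word (t - r))"
    using free.subspace_neg[OF subspace_relations pq]
    by (simp add: tensor_eq_iff lin_ext_diff algebra_simps)
  also have "\<dots> = tensor UNIV s p + hochschild_b s (tensor UNIV s (t - r))"
    by (simp add: hochschild_b_tensor tensor_add)
  finally show "X \<in> homology_class s I n (tensor UNIV s p)"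
    using rel_chains_diff[OF I Y[unfolded t] r]
    unfolding homology_class_def rel_boundaries_def elt_set_plus_def by blast
qed

lemma homology_class_eq:
  assumes I: "subspace I" and r: "tensor UNIV s r \<in> rel_chains s I (Suc n)"
    and pq: "p - q - lin_ext b_word r \<in> multilinear_relations UNIV s"
  shows "homology_class s I n (tensor UNIV s q) = homology_class s I n (tensor UNIV s p)"
proof
  show "homology_class s I n (tensor UNIV s p) \<subseteq> homology_class s I n (tensor UNIV s q)"
  proof (rule homology_class_subset[OF I])
    (* Written so that closure of the relative chains under differences gives the negative of r. *)
    show "tensor UNIV s (r - r - r) \<in> rel_chains s I (Suc n)"
      by (intro rel_chains_diff I r)
    have "q - p - lin_ext b_word (r - r - r) = - (p - q - lin_ext b_word r)"
      by (simp only: lin_ext_diff) simp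
    then show "q - p - lin_ext b_word (r - r - r) \<in> multilinear_relations UNIV s"
      using free.subspace_neg[OF subspace_relations pq] by (simp only:)
  qed
qed (rule homology_class_subset[OF assms])

end


section \<open>The cycle $\varphi'$ in $C_n(I)$\<close>

theorem proposition9:
  fixes scale :: "'k::field_char_0 \<Rightarrow> 'a::ring \<Rightarrow> 'a"
    and I :: "'a set"
    and \<sigma> :: "'a set \<Rightarrow> 'a"
    and B\<^sub>I :: "'a set" and B\<^sub>Q :: "'a set set"
    and n :: nat
    and J :: "'j set" and lam :: "'j \<Rightarrow> 'k" and f :: "'j \<Rightarrow> nat \<Rightarrow> 'a"
    and e :: "nat \<Rightarrow> 'a"
    and \<phi> \<phi>' :: "('a list \<Rightarrow>\<^sub>0 'k) set"
  assumes algebra: "nonunital_algebra scale"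
    and ideal: "two_sided_ideal scale I"
    and units: "has_local_left_units I" "has_local_left_units (UNIV :: 'a set)"
    and splitting: "linear_section scale I \<sigma>"
    and bases: "subspace_basis scale I B\<^sub>I" "quot_basis scale I B\<^sub>Q"
    and n: "n \<ge> 1"
    and chain: "\<phi> \<in> rel_filt_chains scale I n n"
    and cycle: "hochschild_b scale \<phi> = tensor UNIV scale 0"
    and J: "finite J"
    and phi: "\<phi> = tensor UNIV scale (\<Sum>j\<in>J. fscale (lam j) (word (map (f j) [0..<Suc n])))"
    and slot_0: "\<And>j. j \<in> J \<Longrightarrow> f j 0 \<in> B\<^sub>I"
    and slots: "\<And>j i. j \<in> J \<Longrightarrow> 1 \<le> i \<Longrightarrow> i \<le> n \<Longrightarrow> f j i \<in> B\<^sub>I \<union> \<sigma> ` B\<^sub>Q"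
    and e_n: "e n \<in> I" "local_left_unit (e n) {f j 0 | j. j \<in> J}"
    and e_step: "\<And>i. 2 \<le> i \<Longrightarrow> i \<le> n \<Longrightarrow>
      e (i - 1) \<in> I \<and> local_left_unit (e (i - 1)) ({e i} \<union> {f j i * e i | j. j \<in> J})"
    and phi': "\<phi>' = tensor UNIV scale (\<Sum>j\<in>J. fscale (lam j) (pure_prime n e (f j)))"
  shows "\<phi>' \<in> rel_filt_chains scale I 0 n \<and> \<phi>' \<in> rel_cycles scale I n \<and>
    homology_class scale I n \<phi>' = homology_class scale I n \<phi>"
proof -
  interpret nonunital_algebra scale
    by (rule algebra)
  let ?R = "multilinear_relations UNIV scale :: ('a list \<Rightarrow>\<^sub>0 'k) set"
  let ?P = "\<lambda>m. \<Sum>j\<in>J. fscale (lam j) (partial_shift n e (f j) m)"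
  have I: "subspace I" and I_mult: "\<And>a x. x \<in> I \<Longrightarrow> a * x \<in> I"
    using ideal by (auto simp: two_sided_ideal_def)
  have e: "e i \<in> I" if "1 \<le> i" "i \<le> n" for i
    using that e_n(1) e_step[of "Suc i"] by (cases "i = n") auto
  have f0: "f j 0 \<in> I" if "j \<in> J" for j
    using slot_0[OF that] bases(1) span_base unfolding subspace_basis_def by blast
  have Pn: "\<phi> = tensor UNIV scale (?P n)" and P0: "\<phi>' = tensor UNIV scale (?P 0)"
    by (simp_all only: phi phi' partial_shift_start partial_shift_end)
  have b_Pn: "lin_ext b_word (?P n) \<in> ?R"
    using cycle by (simp add: Pn hochschild_b_tensor tensor_eq_iff)
  have "\<exists>r\<in>first_slot_chains I (Suc n). ?P n - fscale (((-1) ^ Suc n) ^ (n - 0)) (?P 0)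
      - lin_ext b_word r \<in> ?R"
  proof (rule partial_shifts_homologous[OF n le0 e _ _ b_Pn])
    show "e n * f j 0 = f j 0" if "j \<in> J" for j
      using e_n(2) that unfolding local_left_unit_def by blast
    show "e i * e (Suc i) = e (Suc i) \<and> e i * (f j (Suc i) * e (Suc i)) = f j (Suc i) * e (Suc i)"
      if "1 \<le> i" "i < n" "j \<in> J" for i j
      using e_step[of "Suc i"] that unfolding local_left_unit_def by auto
  qed
  moreover have "((-1) ^ Suc n) ^ (n - 0) = (1 :: 'k)"
    by (simp add: power_mult[symmetric] del: power_Suc)
  ultimately obtain r where r: "r \<in> first_slot_chains I (Suc n)"
    and hom: "?P n - ?P 0 - lin_ext b_word r \<in> ?R"
    by auto
  have span: "?P 0 \<in> free.span {word w | w. length w = Suc n \<and> set w \<subseteq> I}"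
    using set_tail_iter[of 0 n _ I e] f0 e I_mult
    by (intro free.span_sum free.span_scale partial_shift_in_span) auto
  have "set w \<subseteq> I \<longleftrightarrow> (\<forall>i. i + 0 \<le> n \<longrightarrow> w ! i \<in> I)" if "length w = Suc n" for w
    using that by (auto simp: set_conv_nth less_Suc_eq_le)
  then have "{word w | w. length w = Suc n \<and> set w \<subseteq> I}
      = {word w :: 'a list \<Rightarrow>\<^sub>0 'k | w. length w = Suc n \<and> (\<forall>i. i + 0 \<le> n \<longrightarrow> w ! i \<in> I)}"
    by (intro Collect_cong) metis
  with span have filt: "\<phi>' \<in> filt_chains scale I 0 n"
    unfolding filt_chains_def P0 by auto
  have "{word w | w. length w = Suc n \<and> set w \<subseteq> I}
      \<subseteq> {word w :: 'a list \<Rightarrow>\<^sub>0 'k | w. length w = Suc n \<and> hd w \<in> I}"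
    by (force simp: length_Suc_conv)
  with span have "?P 0 \<in> first_slot_chains I n"
    unfolding first_slot_chains_def using free.span_mono by blast
  then have rel: "\<phi>' \<in> rel_chains scale I n"
    unfolding P0 by (rule first_slot_chains_rel_chains[OF I])
  have "hochschild_b scale \<phi>' = tensor UNIV scale 0"
    using cycle_if_homologous[OF b_Pn hom] by (simp add: P0 hochschild_b_tensor tensor_eq_iff)
  moreover have "homology_class scale I n \<phi>' = homology_class scale I n \<phi>"
    unfolding Pn P0 by (rule homology_class_eq[OF I first_slot_chains_rel_chains[OF I r] hom])
  ultimately show ?thesis
    using filt rel by (simp add: rel_filt_chains_def rel_cycles_def)
qed

end
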